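(* Let $n\ge 3$ and let $a_1,\dots,a_n\ge 2$ be pairwise coprime integers. Suppose that the minimal resolution of the corresponding Brieskorn singularity, i.e. the plumbed 4-manifold of the minimal star-shaped resolution graph with boundary $\Sigma(a_1,\dots,a_n)$, is an $E_8$-bounding of $\Sigma(a_1,\dots,a_n)$ with intersection form isomorphic to $-E_8$. Then $\Sigma(a_1,\dots,a_n)$ is one of $\Sigma(2,3,5)$, $\Sigma(3,4,7)$, $\Sigma(2,3,7,11)$, $\Sigma(2,3,7,23)$, $\Sigma(3,4,7,43)$.
   Context: $\Sigma(a_1,\dots,a_n)$ is the Brieskorn (Seifert) homology 3-sphere with $n$ singular fibers of multiplicities $a_1,\dots,a_n$, oriented as the link of a complex surface singularity, so that it bounds a negative-definite plumbing. $-E_8$ is the negative-definite even unimodular form of rank 8. A weighted graph (tree with integer vertex weights) is star-shaped if it has at most one vertex of valency $\ge 3$. Let $G$ be a connected star-shaped graph with central vertex $v_0$ (of valency $\ge 3$) of weight $m_0$ and other vertices $v_i^j$ (the $i$-th vertex on the $j$-th branch) of weight $m_i^j$. $G$ is called minimal if its incidence matrix (weights on the diagonal, $1$ for each edge) is negative-definite, $m_0\le -1$, and $m_i^j\le -2$ for all $i,j$. Such a graph determines, by plumbing disk bundles over $S^2$, a negative-definite 4-manifold with Seifert boundary, and each $\Sigma(a_1,\dots,a_n)$ is the boundary of the plumbing of a unique minimal star-shaped graph with $n$ branches; this plumbing is the minimal resolution. An $E_8$-bounding of $Y$ is a spin 4-manifold $X$ with $\partial X=Y$ and intersection form a direct sum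 of copies of $-E_8$ (or of copies of $E_8$). *)

theory Defs
  imports "HOL-Library.Multiset" "HOL-Algebra.Free_Abelian_Groups"
begin

text \<open>
  An integral symmetric bilinear form is a matrix \<open>Q\<close> of integers indexed by a finite set \<open>V\<close>;
  it lives on the free abelian group with basis \<open>V\<close>.
\<close>

definition form :: "('v \<Rightarrow> 'v \<Rightarrow> int) \<Rightarrow> ('v \<Rightarrow>\<^sub>0 int) \<Rightarrow> ('v \<Rightarrow>\<^sub>0 int) \<Rightarrow> int" where
  "form Q x y =
     (\<Sum>u\<in>Poly_Mapping.keys x. \<Sum>v\<in>Poly_Mapping.keys y.
        Poly_Mapping.lookup x u * Q u v * Poly_Mapping.lookup y v)"

definition negative_definite :: "'v set \<Rightarrow> ('v \<Rightarrow> 'v \<Rightarrow> int) \<Rightarrow> bool" where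
  "negative_definite V Q \<longleftrightarrow>
     (\<forall>x\<in>carrier (free_Abelian_group V). x \<noteq> 0 \<longrightarrow> form Q x x < 0)"

definition even_form :: "'v set \<Rightarrow> ('v \<Rightarrow> 'v \<Rightarrow> int) \<Rightarrow> bool" where
  "even_form V Q \<longleftrightarrow> (\<forall>x\<in>carrier (free_Abelian_group V). even (form Q x x))"

definition isometric ::
  "'v set \<Rightarrow> ('v \<Rightarrow> 'v \<Rightarrow> int) \<Rightarrow> 'w set \<Rightarrow> ('w \<Rightarrow> 'w \<Rightarrow> int) \<Rightarrow> bool" where
  "isometric V Q W R \<longleftrightarrow>
     (\<exists>f\<in>iso (free_Abelian_group V) (free_Abelian_group W).
        \<forall>x\<in>carrier (free_Abelian_group V). \<forall>y\<in>carrier (free_Abelian_group V).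
          form R (f x) (f y) = form Q x y)"

text \<open>
  The Dynkin diagram \<open>E\<^sub>8\<close> is the chain \<open>0 - 1 - 2 - 3 - 4 - 5 - 6\<close> with \<open>7\<close> attached to \<open>4\<close>.
\<close>

definition E8_edges :: "nat set set" where
  "E8_edges = {{0, 1}, {1, 2}, {2, 3}, {3, 4}, {4, 5}, {5, 6}, {4, 7}}"

definition neg_E8 :: "nat \<Rightarrow> nat \<Rightarrow> int" where
  "neg_E8 i j = (if i = j then - 2 else if {i, j} \<in> E8_edges then 1 else 0)"

definition pos_E8 :: "nat \<Rightarrow> nat \<Rightarrow> int" where
  "pos_E8 i j = - neg_E8 i j"

text \<open>The orthogonal sum of copies of \<open>Q\<close>; the first component of an index names the copy.\<close>

definition copies :: "('v \<Rightarrow> 'v \<Rightarrow> int) \<Rightarrow> nat \<times> 'v \<Rightarrow> nat \<times> 'v \<Rightarrow> int" where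
  "copies Q p q = (if fst p = fst q then Q (snd p) (snd q) else 0)"


text \<open>
  A connected star-shaped weighted tree with a chosen central vertex is given by the central
  weight and the weights along each branch, listed from the centre outwards. \<open>Leg j i\<close> is the
  \<open>i\<close>-th vertex on the \<open>j\<close>-th branch, both counted from 0.
\<close>

datatype star_graph = Star (central_weight: int) (branches: "int list list")

datatype vertex = Centre | Leg nat nat

definition vertices :: "star_graph \<Rightarrow> vertex set" where
  "vertices G = insert Centre
     {Leg j i | j i. j < length (branches G) \<and> i < length (branches G ! j)}"

fun weight :: "star_graph \<Rightarrow> vertex \<Rightarrow> int" where
  "weight G Centre = central_weight G"
| "weight G (Leg j i) = branches G ! j ! i"

definition edges :: "star_graph \<Rightarrow> vertex set set" where
  "edges G =
     {{Centre, Leg j 0} | j. Leg j 0 \<in> vertices G} \<union>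
     {{Leg j i, Leg j (Suc i)} | j i. Leg j (Suc i) \<in> vertices G}"

definition incidence :: "star_graph \<Rightarrow> vertex \<Rightarrow> vertex \<Rightarrow> int" where
  "incidence G u v = (if u = v then weight G u else if {u, v} \<in> edges G then 1 else 0)"

text \<open>As branches are nonempty, the valency of the central vertex is the number of branches.\<close>

definition minimal_star :: "star_graph \<Rightarrow> bool" where
  "minimal_star G \<longleftrightarrow>
     length (branches G) \<ge> 3 \<and> [] \<notin> set (branches G) \<and>
     negative_definite (vertices G) (incidence G) \<and>
     central_weight G \<le> - 1 \<and>
     (\<forall>b\<in>set (branches G). \<forall>m\<in>set b. m \<le> - 2)"


text \<open>
  Unnormalised Seifert invariants over the 2-sphere. \<open>Seifert b [(\<alpha>\<^sub>1, \<beta>\<^sub>1), \<dots>, (\<alpha>\<^sub>n, \<beta>\<^sub>n)]\<close> stands for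
  the oriented 3-manifold obtained by surgery on an unknot with framing \<open>b\<close> and \<open>n\<close> of its
  meridians with coefficients \<open>- \<alpha>\<^sub>j / \<beta>\<^sub>j\<close>. In this convention its Euler number is
  \<open>b + \<Sum>\<^sub>j \<beta>\<^sub>j / \<alpha>\<^sub>j\<close>, and \<open>(\<alpha>, \<beta>)\<close> with \<open>\<alpha> = 1\<close> is a regular fibre.
\<close>

datatype seifert = Seifert (section_number: int) (fibres: "(int \<times> int) list")

definition seifert_wf :: "seifert \<Rightarrow> bool" where
  "seifert_wf Y \<longleftrightarrow> (\<forall>(\<alpha>, \<beta>)\<in>set (fibres Y). \<alpha> \<ge> 1 \<and> coprime \<alpha> \<beta>)"

definition euler_number :: "seifert \<Rightarrow> rat" where
  "euler_number Y = of_int (section_number Y) +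
     (\<Sum>(\<alpha>, \<beta>)\<leftarrow>fibres Y. of_int \<beta> / of_int \<alpha>)"

definition singular_multiplicities :: "seifert \<Rightarrow> int multiset" where
  "singular_multiplicities Y = {#\<alpha> \<in># mset (map fst (fibres Y)). \<alpha> \<ge> 2#}"

text \<open>
  The Brieskorn sphere \<open>\<Sigma>(a\<^sub>1, \<dots>, a\<^sub>n)\<close>, as the set of all Seifert invariants describing it.
  A Seifert manifold over the 2-sphere has first homology of order
  \<open>\<alpha>\<^sub>1 \<cdots> \<alpha>\<^sub>n \<bar>e\<bar>\<close> (infinite if \<open>e = 0\<close>), and it is oriented as a singularity link iff its Euler
  number \<open>e\<close> is negative. So the homology sphere with singular fibres of multiplicities
  \<open>a\<^sub>1, \<dots>, a\<^sub>n\<close> and this orientation has \<open>e = - 1 / (a\<^sub>1 \<cdots> a\<^sub>n)\<close>. For pairwise coprime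
  \<open>a\<^sub>j\<close> this fixes each \<open>\<beta>\<^sub>j\<close> modulo \<open>a\<^sub>j\<close>, hence one class of Seifert invariants up to
  orientation-preserving equivalence.
\<close>

definition Brieskorn :: "nat list \<Rightarrow> seifert set" where
  "Brieskorn a =
     {Y. seifert_wf Y \<and> singular_multiplicities Y = mset (map int a) \<and>
         euler_number Y = - 1 / of_nat (prod_list a)}"

text \<open>
  \<open>branch_pair [m\<^sub>1, \<dots>, m\<^sub>k] = (\<alpha>, \<beta>)\<close> computes the continued fraction
  \<open>\<alpha> / \<beta> = - m\<^sub>1 - 1 / (- m\<^sub>2 - 1 / (\<dots> - 1 / (- m\<^sub>k)))\<close> in lowest terms.
\<close>

fun branch_pair :: "int list \<Rightarrow> int \<times> int" where
  "branch_pair [] = (1, 0)"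
| "branch_pair (m # ms) = (case branch_pair ms of (p, q) \<Rightarrow> (- m * p - q, p))"

text \<open>
  The boundary of the plumbing of a star-shaped graph: slam-dunking each branch into its
  meridian of the central unknot turns the plumbing diagram into a Seifert surgery diagram.
\<close>

definition plumbing_boundary :: "star_graph \<Rightarrow> seifert" where
  "plumbing_boundary G = Seifert (central_weight G) (map branch_pair (branches G))"

text \<open>
  The second homology of the plumbing is free on the zero sections, one for each vertex, and
  its intersection form is the incidence matrix. The plumbing is simply connected, so by Wu's
  formula its second Stiefel-Whitney class is the map \<open>x \<mapsto> x \<cdot> x\<close> modulo 2.
\<close>

abbreviation plumbing_form_isometric :: "star_graph \<Rightarrow> 'w set \<Rightarrow> ('w \<Rightarrow> 'w \<Rightarrow> int) \<Rightarrow> bool" where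
  "plumbing_form_isometric G W R \<equiv> isometric (vertices G) (incidence G) W R"

definition plumbing_spin :: "star_graph \<Rightarrow> bool" where
  "plumbing_spin G \<longleftrightarrow> even_form (vertices G) (incidence G)"

definition E8_bounding :: "star_graph \<Rightarrow> seifert set \<Rightarrow> bool" where
  "E8_bounding G Y \<longleftrightarrow>
     plumbing_spin G \<and> plumbing_boundary G \<in> Y \<and>
     (\<exists>k. plumbing_form_isometric G ({..<k} \<times> {..<8}) (copies neg_E8) \<or>
          plumbing_form_isometric G ({..<k} \<times> {..<8}) (copies pos_E8))"

definition minimal_resolution_graph :: "star_graph \<Rightarrow> nat list \<Rightarrow> bool" where
  "minimal_resolution_graph G a \<longleftrightarrow>
     minimal_star G \<and> length (branches G) = length a \<and> plumbing_boundary G \<in> Brieskorn a"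

end

theory Submission imports Defs begin

text \<open>
  Only the rank and the evenness of the form matter. The branches have \<open>7\<close> vertices in total and
  all weights are even, so a multiplicity \<open>\<alpha>\<^sub>j\<close> is even iff its branch has odd length; by
  coprimality exactly one branch has odd length, which leaves the length patterns \<open>1, 2, 4\<close>,
  \<open>2, 2, 3\<close> and \<open>1, 2, 2, 2\<close>. The Euler number gives
  \<open>\<Sum>\<^sub>j \<beta>\<^sub>j / \<alpha>\<^sub>j + 1 / (\<alpha>\<^sub>1 \<cdots> \<alpha>\<^sub>n) = - m\<^sub>0\<close>, where a branch of length \<open>k\<close> has
  \<open>\<beta> / \<alpha> \<le> k / (k + 1)\<close>. This forces \<open>m\<^sub>0 = - 2\<close>. For the first two patterns the largest
  admissible values of \<open>\<beta>\<^sub>j / \<alpha>\<^sub>j\<close> come with the smallest \<open>\<alpha>\<^sub>j\<close> and bring the left-hand side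
  exactly to \<open>2\<close>, so the solution is unique; the third pattern reduces to two factorable Diophantine equations.
\<close>

section \<open>Continued fractions of the branches\<close>

text \<open>Chains of \<open>k\<close> weights \<open>- 2\<close> attain both bounds, with fraction
  \<open>(k + 1) / k\<close>. The induction also carries \<open>p \<ge> q + 1\<close>, which makes
  the numerator grow at every step.\<close>

lemma branch_pair_bounds:
  assumes "\<forall>m\<in>set ms. m \<le> - 2"
  shows "fst (branch_pair ms) \<ge> int (length ms) + 1"
    and "(int (length ms) + 1) * snd (branch_pair ms) \<le> int (length ms) * fst (branch_pair ms)"
proof -
  have "case branch_pair ms of (p, q) \<Rightarrow> p \<ge> int (length ms) + 1 \<and> p \<ge> q + 1 \<and>
      (int (length ms) + 1) * q \<le> int (length ms) * p"
    using assms
  proof (induction ms)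
    case (Cons m ms)
    obtain p q where pq: "branch_pair ms = (p, q)" by fastforce
    define k where "k = int (length ms)"
    have IH: "p \<ge> k + 1" "p \<ge> q + 1" "(k + 1) * q \<le> k * p" and "k \<ge> 0"
      using Cons pq by (auto simp: k_def)
    have "(- m) * p \<ge> 2 * p"
      using Cons.prems IH \<open>k \<ge> 0\<close> by (intro mult_right_mono) auto
    then have p': "- m * p - q \<ge> 2 * p - q" by simp
    have "(k + 1) * (- m * p - q) \<ge> (k + 1) * (2 * p - q)"
      using p' \<open>k \<ge> 0\<close> by (intro mult_left_mono) auto
    moreover have "(k + 1) * (2 * p - q) \<ge> (k + 2) * p"
      using IH(3) by (simp add: algebra_simps)
    moreover have "- m * p - q \<ge> p + 1" using p' IH by linarith
    ultimately have "- m * p - q \<ge> k + 2 \<and> - m * p - q \<ge> p + 1 \<and> (k + 2) * p \<le> (k + 1) * (- m * p - q)"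
      using IH by linarith
    then show ?case by (simp add: pq k_def algebra_simps)
  qed simp
  then show "fst (branch_pair ms) \<ge> int (length ms) + 1"
    and "(int (length ms) + 1) * snd (branch_pair ms) \<le> int (length ms) * fst (branch_pair ms)"
    by (auto split: prod.splits)
qed

text \<open>Modulo 2 an even weight turns the recursion into a swap of \<open>p\<close> and
  \<open>q\<close>, started at \<open>(1, 0)\<close>.\<close>

lemma even_fst_branch_pair_iff:
  assumes "\<forall>m\<in>set ms. even m"
  shows "even (fst (branch_pair ms)) \<longleftrightarrow> odd (length ms)"
proof -
  have "case branch_pair ms of (p, q) \<Rightarrow>
      (even p \<longleftrightarrow> odd (length ms)) \<and> (even q \<longleftrightarrow> even (length ms))"
    using assms by (induction ms) (auto split: prod.splits)
  then show ?thesis by (auto split: prod.splits)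
qed

section \<open>Rank and parity of the plumbing form\<close>

lemma form_frag_of: "form Q (frag_of v) (frag_of v) = Q v v"
  by (simp add: form_def)

lemma incidence_weights_even:
  assumes "even_form (vertices G) (incidence G)" and "v \<in> vertices G"
  shows "even (weight G v)"
proof -
  have "frag_of v \<in> carrier (free_Abelian_group (vertices G))"
    using assms(2) by simp
  then have "even (form (incidence G) (frag_of v) (frag_of v))"
    using assms(1) unfolding even_form_def by blast
  then show ?thesis by (simp add: form_frag_of incidence_def)
qed

lemma card_vertices: "card (vertices G) = Suc (sum_list (map length (branches G)))"
proof -
  define S where "S = Sigma {..<length (branches G)} (\<lambda>j. {..<length (branches G ! j)})"
  have eq: "vertices G = insert Centre ((\<lambda>(j, i). Leg j i) ` S)"
    by (auto simp: vertices_def S_def)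
  have "finite S" by (simp add: S_def)
  have "card ((\<lambda>(j, i). Leg j i) ` S) = card S"
    by (intro card_image) (auto simp: inj_on_def)
  also have "\<dots> = (\<Sum>j<length (branches G). length (branches G ! j))"
    by (simp add: S_def)
  also have "\<dots> = sum_list (map length (branches G))"
    by (simp add: sum_list_sum_nth atLeast0LessThan)
  finally show ?thesis using \<open>finite S\<close> by (subst eq, subst card_insert_disjoint) auto
qed

text \<open>An isometry is an isomorphism of free abelian groups, and the group determines the
  cardinality of a basis. This yields the number of vertices.\<close>

lemma isometric_imp_eqpoll:
  assumes "isometric V Q W R"
  shows "V \<approx> W"
  using assms isomorphic_free_Abelian_groups[of V W] by (auto simp: isometric_def is_iso_def)

text \<open>The multiplicities are found only up to order; the defining conditions see just their
  multiset and product.\<close>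

lemma Brieskorn_cong:
  assumes "mset a = mset b"
  shows "Brieskorn a = Brieskorn b"
proof -
  have "prod_list a = prod_list b"
    using assms by (metis prod_mset_prod_list)
  then show ?thesis using assms by (simp add: Brieskorn_def)
qed

section \<open>Multiplicity and slope of a branch with even weights\<close>

definition multiplicity :: "int list \<Rightarrow> int" where
  "multiplicity ms = fst (branch_pair ms)"

text \<open>The contribution \<beta> / \<alpha> of the branch to the Euler number of the
  boundary.\<close>

definition slope :: "int list \<Rightarrow> rat" where
  "slope ms = of_int (snd (branch_pair ms)) / of_int (multiplicity ms)"

definition even_branch :: "int list \<Rightarrow> bool" where
  "even_branch ms \<longleftrightarrow> ms \<noteq> [] \<and> (\<forall>m\<in>set ms. even m \<and> m \<le> - 2)"

lemma multiplicity_ge: "even_branch ms \<Longrightarrow> multiplicity ms \<ge> int (length ms) + 1"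
  using branch_pair_bounds(1)[of ms] by (auto simp: even_branch_def multiplicity_def)

lemma even_multiplicity_iff: "even_branch ms \<Longrightarrow> even (multiplicity ms) \<longleftrightarrow> odd (length ms)"
  using even_fst_branch_pair_iff[of ms] by (auto simp: even_branch_def multiplicity_def)

lemma slope_le:
  assumes "even_branch ms"
  shows "slope ms \<le> of_nat (length ms) / of_nat (length ms + 1)"
proof -
  define k where "k = int (length ms)"
  have "(k + 1) * snd (branch_pair ms) \<le> k * multiplicity ms"
    using assms branch_pair_bounds(2)[of ms]
    by (auto simp: even_branch_def multiplicity_def k_def)
  then have "rat_of_int ((k + 1) * snd (branch_pair ms)) \<le> of_int (k * multiplicity ms)"
    by (simp only: of_int_le_iff)
  moreover have "k \<ge> 0" "multiplicity ms > 0"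
    using multiplicity_ge[OF assms] by (auto simp: k_def)
  ultimately have "slope ms \<le> of_int k / of_int (k + 1)"
    by (simp add: slope_def field_simps)
  then show ?thesis by (simp add: k_def add.commute)
qed

lemma multiplicity_slope_length_1:
  assumes "even_branch ms" "length ms = 1"
  shows "slope ms = 1 / of_int (multiplicity ms)"
  using assms(2) by (auto simp: length_Suc_conv slope_def multiplicity_def)

text \<open>For weights \<open>- d\<close>, \<open>- e\<close> one has \<open>p = d * e - 1\<close>
  and \<open>s = e / p = 1 / d + 1 / (d * p)\<close>. The first table is ordered by
  \<open>p\<close>; the second distinguishes \<open>d = 2\<close>, \<open>d = 4\<close> and
  \<open>d \<ge> 6\<close>.\<close>

lemma multiplicity_slope_length_2:
  assumes "even_branch ms" "length ms = 2"
  defines "p \<equiv> multiplicity ms" and "s \<equiv> slope ms"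
  shows "p = 3 \<and> s \<le> 2 / 3 \<or> p = 7 \<and> s \<le> 4 / 7 \<or> p \<ge> 11 \<and> s \<le> 6 / 11"
    and "s = 1 / 2 + 1 / (2 * of_int p) \<or> p \<ge> 7 \<and> s = 1 / 4 + 1 / (4 * of_int p) \<and> s \<le> 2 / 7 \<or>
      p \<ge> 11 \<and> s \<le> 2 / 11"
proof -
  obtain m n where ms: "ms = [m, n]"
    using assms(2) by (auto simp: numeral_2_eq_2 length_Suc_conv)
  define d e where "d = - m" and "e = - n"
  have de: "even d" "even e" "d \<ge> 2" "e \<ge> 2"
    using assms(1) by (auto simp: even_branch_def ms d_def e_def)
  have p: "p = d * e - 1" and s: "s = of_int e / of_int p"
    by (simp_all add: p_def s_def slope_def multiplicity_def ms d_def e_def)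
  have "2 * 2 \<le> d * e" using de by (intro mult_mono) auto
  then have "p > 0" using p by simp
  have s_le: "s \<le> of_int k / of_int l" if "l * e \<le> k * p" "l > 0" for k l
  proof -
    have "rat_of_int (l * e) \<le> of_int (k * p)" using that by (simp only: of_int_le_iff)
    then show ?thesis using \<open>p > 0\<close> that by (simp add: s field_simps)
  qed
  \<comment> \<open>The first three pairs give \<open>p = 3\<close>, \<open>7\<close>,
    \<open>7\<close>; the other three cases give \<open>p \<ge> 11\<close>.\<close>
  consider "d = 2" "e = 2" | "d = 2" "e = 4" | "d = 4" "e = 2" | "d = 2" "e \<ge> 6"
    | "d = 4" "e \<ge> 4" | "d \<ge> 6"
  proof -
    have "d = 2 \<or> d = 4 \<or> d \<ge> 6" "e = 2 \<or> e = 4 \<or> e \<ge> 6"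
      using de by presburger+
    then show thesis using that by force
  qed
  then have "(p = 3 \<and> s \<le> 2 / 3 \<or> p = 7 \<and> s \<le> 4 / 7 \<or> p \<ge> 11 \<and> s \<le> 6 / 11) \<and>
    (s = 1 / 2 + 1 / (2 * of_int p) \<or> p \<ge> 7 \<and> s = 1 / 4 + 1 / (4 * of_int p) \<and> s \<le> 2 / 7 \<or>
      p \<ge> 11 \<and> s \<le> 2 / 11)"
  proof cases
    case 6
    have "6 * e \<le> d * e" using 6 de by (intro mult_right_mono) auto
    then have "11 * e \<le> 2 * p" "p \<ge> 11" using p de by linarith+
    then show ?thesis using s_le[of 11 2] by auto
  next
    case 4
    then have "s = 1 / 2 + 1 / (2 * of_int p)" "p \<ge> 11" "11 * e \<le> 6 * p"
      using p by (auto simp: s field_simps)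
    then show ?thesis using s_le[of 11 6] by auto
  next
    case 5
    then have "s = 1 / 4 + 1 / (4 * of_int p)" "p \<ge> 11" "11 * e \<le> 6 * p" "7 * e \<le> 2 * p"
      using p by (auto simp: s field_simps)
    then show ?thesis using s_le[of 11 6] s_le[of 7 2] by auto
  qed (auto simp: s p)
  then show "p = 3 \<and> s \<le> 2 / 3 \<or> p = 7 \<and> s \<le> 4 / 7 \<or> p \<ge> 11 \<and> s \<le> 6 / 11"
    and "s = 1 / 2 + 1 / (2 * of_int p) \<or> p \<ge> 7 \<and> s = 1 / 4 + 1 / (4 * of_int p) \<and> s \<le> 2 / 7 \<or>
      p \<ge> 11 \<and> s \<le> 2 / 11"
    by auto
qed

section \<open>Reciprocals of products with factors bounded below\<close>

lemma inverse_prod3_le: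
  fixes A B C :: int
  assumes "a \<le> A" "b \<le> B" "c \<le> C" "0 < a" "0 < b" "0 < c"
  shows "1 / (rat_of_int A * of_int B * of_int C) \<le> 1 / of_int (a * b * c)"
proof -
  have "a * b * c \<le> A * B * C" using assms by (intro mult_mono) auto
  then have "rat_of_int (a * b * c) \<le> of_int (A * B * C)" by (simp only: of_int_le_iff)
  then have "1 / rat_of_int (A * B * C) \<le> 1 / of_int (a * b * c)"
    using assms by (intro divide_left_mono) (auto intro!: mult_pos_pos)
  then show ?thesis by simp
qed

lemma inverse_prod4_le:
  fixes A B C D :: int
  assumes "a \<le> A" "b \<le> B" "c \<le> C" "d \<le> D" "0 < a" "0 < b" "0 < c" "0 < d"
  shows "1 / (rat_of_int A * of_int B * of_int C * of_int D) \<le> 1 / of_int (a * b * c * d)"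
proof -
  have "a * b * 1 \<le> A * B * 1" using assms by (intro mult_mono) auto
  then show ?thesis
    using inverse_prod3_le[of "a * b" "A * B" c C d D] assms by auto
qed

text \<open>If one factor exceeds its bound, so does the product. This turns a sharp estimate of the
  Euler number into uniqueness of the multiplicities.\<close>

lemma prod3_eq_minimal:
  fixes A B C :: int
  assumes "a \<le> A" "b \<le> B" "c \<le> C" "0 < a" "0 < b" "0 < c"
    and "1 / of_int (a * b * c) \<le> 1 / (rat_of_int A * of_int B * of_int C)"
  shows "A = a" "B = b" "C = c"
proof -
  have le: "A * B * C \<le> a * b * c"
  proof (rule ccontr)
    assume "\<not> A * B * C \<le> a * b * c"
    then have "rat_of_int (a * b * c) < of_int (A * B * C)" by (simp only: of_int_less_iff)
    moreover have "0 < rat_of_int (a * b * c)" using assms by simp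
    ultimately have "1 / rat_of_int (A * B * C) < 1 / of_int (a * b * c)"
      by (intro divide_strict_left_mono) (auto intro!: mult_pos_pos)
    then show False using assms(7) by simp
  qed
  have "False" if "x < X" "y \<le> Y" "z \<le> Z" "0 < x" "0 < y" "0 < z" "X * Y * Z \<le> x * y * z"
    for x X y Y z Z :: int
  proof -
    have "x * (y * z) < X * (y * z)" using that by (intro mult_strict_right_mono) auto
    also have "\<dots> \<le> X * (Y * Z)" using that by (intro mult_left_mono mult_mono) auto
    finally show False using that by (simp add: mult.assoc)
  qed
  \<comment> \<open>Each instance moves another factor to the front as the strictly larger
    one.\<close>
  from this[of a A b B c C] this[of b B a A c C] this[of c C a A b B]
  show "A = a" "B = b" "C = c"
    using le assms by (auto simp: mult_ac intro: ccontr)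
qed

section \<open>The three patterns of branch lengths\<close>

text \<open>The slope bounds add up to \<open>1/2 + 2/3 + 4/5 = 2 - 1/30\<close>, so the reciprocal
  of the product is at least \<open>1 / (2 * 3 * 5)\<close>.\<close>

lemma lengths_1_2_4:
  assumes "even_branch x" "even_branch y" "even_branch z"
    and "length x = 1" "length y = 2" "length z = 4"
    and N: "N = 2 \<or> N \<ge> 4"
    and eq: "slope x + slope y + slope z +
      1 / (of_int (multiplicity x) * of_int (multiplicity y) * of_int (multiplicity z)) = N"
  shows "multiplicity x = 2" "multiplicity y = 3" "multiplicity z = 5"
proof -
  have ge: "2 \<le> multiplicity x" "3 \<le> multiplicity y" "5 \<le> multiplicity z"
    using assms multiplicity_ge[of x] multiplicity_ge[of y] multiplicity_ge[of z] by auto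
  have "slope x \<le> 1 / 2" "slope y \<le> 2 / 3" "slope z \<le> 4 / 5"
    using assms slope_le[of x] slope_le[of y] slope_le[of z] by auto
  then have "1 / of_int (2 * 3 * 5) \<le>
      1 / (rat_of_int (multiplicity x) * of_int (multiplicity y) * of_int (multiplicity z))"
    using eq N by auto
  from prod3_eq_minimal[OF ge _ _ _ this]
  show "multiplicity x = 2" "multiplicity y = 3" "multiplicity z = 5" by auto
qed

text \<open>Distinct multiplicities allow only one \<open>3\<close> among the branches of length 2.
  The slope bounds then add up to \<open>2/3 + 4/7 + 3/4 = 2 - 1/84\<close>, with
  \<open>84 = 3 * 7 * 4\<close>.\<close>

lemma lengths_2_2_3:
  assumes "even_branch x" "even_branch y" "even_branch z"
    and "length x = 2" "length y = 2" "length z = 3"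
    and "multiplicity x < multiplicity y"
    and N: "N = 2 \<or> N \<ge> 4"
    and eq: "slope x + slope y + slope z +
      1 / (of_int (multiplicity x) * of_int (multiplicity y) * of_int (multiplicity z)) = N"
  shows "multiplicity x = 3" "multiplicity y = 7" "multiplicity z = 4"
proof -
  note x = multiplicity_slope_length_2(1)[OF assms(1,4)]
  note y = multiplicity_slope_length_2(1)[OF assms(2,5)]
  have z: "multiplicity z \<ge> 4" "slope z \<le> 3 / 4"
    using assms multiplicity_ge[of z] slope_le[of z] by auto
  have ge: "3 \<le> multiplicity x" "7 \<le> multiplicity y"
    using assms(7) x y by auto
  have "slope x \<le> 2 / 3" "slope y \<le> 4 / 7"
    using assms(7) x y by auto
  then have "1 / of_int (3 * 7 * 4) \<le>
      1 / (rat_of_int (multiplicity x) * of_int (multiplicity y) * of_int (multiplicity z))"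
    using eq N z by auto
  from prod3_eq_minimal[OF ge z(1) _ _ _ this]
  show "multiplicity x = 3" "multiplicity y = 7" "multiplicity z = 4" by auto
qed

text \<open>
  With three slopes of the form \<open>1/2 + 1/(2p)\<close> and the fourth equal to \<open>1/4\<close>, the smallest
  multiplicity is \<open>3\<close> and the equation factors as \<open>(B - 6) (C - 6) = 37\<close>.
\<close>

lemma reciprocal_sum_half:
  fixes A B C :: int
  assumes A: "A = 3 \<or> A \<ge> 7" and "A < B" "B < C" and B: "B \<ge> 7" and C: "C \<ge> 11"
    and eq: "2 * (A * B + B * C + A * C) = A * B * C - 1"
  shows "A = 3 \<and> B = 7 \<and> C = 43"
  using A
proof
  assume "A = 3"
  then have "(B - 6) * (C - 6) = 37" using eq by (simp add: algebra_simps)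
  moreover have "B - 6 < 7"
  proof (rule ccontr)
    assume "\<not> B - 6 < 7"
    then have "7 * 7 \<le> (B - 6) * (C - 6)" using assms by (intro mult_mono) auto
    then show False using \<open>(B - 6) * (C - 6) = 37\<close> by simp
  qed
  then have "B - 6 \<in> {1, 2, 3, 4, 5, 6}" using B by auto
  ultimately show ?thesis using \<open>A = 3\<close> by auto presburger+
next
  assume "A \<ge> 7"
  have "A * B \<le> B * C" "A * C \<le> B * C" "7 * (B * C) \<le> A * (B * C)"
    using assms \<open>A \<ge> 7\<close> by (auto intro!: mult_right_mono mult_mono simp: mult.commute)
  moreover have "B * C > 1" using B C by (smt (verit) mult_le_cancel_left1)
  ultimately have False using eq by (simp add: algebra_simps)
  then show ?thesis ..
qed

text \<open>
  If one slope is of the form \<open>1/4 + 1/(4p)\<close> instead and the fourth equals \<open>1/2\<close>, the equation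
  factors as \<open>(B - 6) (C - 3) = 20\<close>.
\<close>

lemma reciprocal_sum_sixth:
  fixes B C :: int
  assumes "odd B" "odd C" "B \<ge> 7" "C \<ge> 7"
    and eq: "6 * C + 3 * B = B * C - 2"
  shows "B = 11 \<and> C = 7 \<or> B = 7 \<and> C = 23"
proof -
  have prod: "(B - 6) * (C - 3) = 20" using eq by (simp add: algebra_simps)
  have "B - 6 < 6"
  proof (rule ccontr)
    assume "\<not> B - 6 < 6"
    then have "6 * 4 \<le> (B - 6) * (C - 3)" using assms by (intro mult_mono) auto
    then show False using prod by simp
  qed
  then have "B - 6 \<in> {1, 3, 5}" using assms(1,3) by auto presburger
  then show ?thesis using prod assms by auto presburger+
qed

text \<open>The single-vertex branch has slope \<open>1 / W\<close> with \<open>W\<close> even.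
  \<open>W \<ge> 6\<close> makes the sum too small, \<open>W = 4\<close> forces three slopes above
  \<open>1/2\<close>, and \<open>W = 2\<close> forces \<open>X = 3\<close> and exactly one smaller
  slope.\<close>

lemma lengths_1_2_2_2:
  assumes "even_branch w" "even_branch x" "even_branch y" "even_branch z"
    and "length w = 1" "length x = 2" "length y = 2" "length z = 2"
    and "multiplicity x < multiplicity y" "multiplicity y < multiplicity z"
    and N: "N = 2 \<or> N \<ge> 4"
    and eq: "slope w + slope x + slope y + slope z +
      1 / (of_int (multiplicity w) * of_int (multiplicity x) * of_int (multiplicity y) *
        of_int (multiplicity z)) = N"
  shows "{#multiplicity w, multiplicity x, multiplicity y, multiplicity z#} \<in>
    {{#2, 3, 7, 11#}, {#2, 3, 7, 23#}, {#3, 4, 7, 43#}}"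
proof -
  define W X Y Z where "W = multiplicity w" and "X = multiplicity x"
    and "Y = multiplicity y" and "Z = multiplicity z"
  define P where "P = 1 / (rat_of_int W * of_int X * of_int Y * of_int Z)"
  define r s t where "r = slope x" and "s = slope y" and "t = slope z"
  note defs = W_def X_def Y_def Z_def r_def s_def t_def
  note x = multiplicity_slope_length_2[OF assms(2,6), folded defs]
  note y = multiplicity_slope_length_2[OF assms(3,7), folded defs]
  note z = multiplicity_slope_length_2[OF assms(4,8), folded defs]
  have ord: "X < Y" "Y < Z" using assms by (auto simp: defs)
  have W: "even W" "W \<ge> 2"
    using even_multiplicity_iff[OF assms(1)] multiplicity_ge[OF assms(1)] assms(5)
    by (auto simp: defs)
  have odd: "odd X" "odd Y" "odd Z"
    using even_multiplicity_iff assms by (auto simp: defs)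
  have eq': "1 / of_int W + r + s + t + P = N"
    using eq multiplicity_slope_length_1[OF assms(1,5)] by (simp add: P_def defs)
  \<comment> \<open>Strict increase pushes the three branches down the first table, and by one
    further row if \<open>X > 3\<close>.\<close>
  have r: "X \<ge> 3" "r \<le> 2 / 3" "X > 3 \<Longrightarrow> X \<ge> 7 \<and> r \<le> 4 / 7"
    and s: "Y \<ge> 7" "s \<le> 4 / 7" "X > 3 \<Longrightarrow> Y \<ge> 11 \<and> s \<le> 6 / 11"
    and t: "Z \<ge> 11" "t \<le> 6 / 11"
    using x(1) y(1) z(1) ord by auto
  \<comment> \<open>Here \<open>462 = 2 * 3 * 7 * 11\<close>.\<close>
  have P: "P \<le> 1 / 462"
    using inverse_prod4_le[OF W(2) r(1) s(1) t(1)] by (simp add: P_def)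
  have posr: "rat_of_int W > 0" "rat_of_int X > 0" "rat_of_int Y > 0" "rat_of_int Z > 0"
    using W r s t by auto
  have "1 / rat_of_int W \<le> 1 / 2"
    using W by (simp add: field_simps)
  then have N2: "N = 2" using N eq' r s t P by auto
  consider "W = 2" | "W = 4" | "W \<ge> 6" using W by fastforce
  then have "{#W, X, Y, Z#} \<in> {{#2, 3, 7, 11#}, {#2, 3, 7, 23#}, {#3, 4, 7, 43#}}"
  proof cases
    case 3
    then have "1 / rat_of_int W \<le> 1 / 6" by (simp add: field_simps)
    then show ?thesis using N2 eq' r s t P by auto
  next
    case 2
    then have sum: "r + s + t + P = 7 / 4" using N2 eq' by simp
    have "r = 1 / 2 + 1 / (2 * of_int X)" using x(2) sum s t P by auto
    moreover have "s = 1 / 2 + 1 / (2 * of_int Y)" using y(2) sum r t P by auto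
    moreover have "t = 1 / 2 + 1 / (2 * of_int Z)" using z(2) sum r s P by auto
    ultimately have "1 / (2 * of_int X) + 1 / (2 * of_int Y) + 1 / (2 * of_int Z) +
        1 / (4 * rat_of_int X * of_int Y * of_int Z) = 1 / 4"
      using sum 2 by (simp add: P_def)
    then have "rat_of_int (2 * (X * Y + Y * Z + X * Z)) = of_int (X * Y * Z - 1)"
      using posr by (simp add: field_simps)
    then have "2 * (X * Y + Y * Z + X * Z) = X * Y * Z - 1" by (simp only: of_int_eq_iff)
    then have "X = 3 \<and> Y = 7 \<and> Z = 43"
      using reciprocal_sum_half[of X Y Z] r s t ord by force
    then show ?thesis using 2 by (simp add: add_mset_commute)
  next
    case 1
    then have sum: "r + s + t + P = 3 / 2" using N2 eq' by simp
    \<comment> \<open>Three slopes above \<open>1/2\<close> would already exceed the total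
      \<open>3/2\<close>.\<close>
    have "r \<le> 2 / 7 \<or> s \<le> 2 / 7 \<or> t \<le> 2 / 7"
    proof (rule ccontr)
      assume "\<not> ?thesis"
      then have "r > 1 / 2" "s > 1 / 2" "t > 1 / 2"
        using x(2) y(2) z(2) posr by auto
      moreover have "P > 0" using posr by (simp add: P_def)
      ultimately show False using sum by simp
    qed
    note exceptional = this
    \<comment> \<open>For \<open>X > 3\<close> the bounds \<open>4/7\<close>, \<open>6/11\<close>,
      \<open>6/11\<close>, one of them lowered to \<open>2/7\<close>, sum with \<open>P\<close> to
      less than \<open>3/2\<close>.\<close>
    have X3: "X = 3"
    proof (rule ccontr)
      assume "X \<noteq> 3"
      then have "X > 3" using r(1) by simp
      with exceptional r(3) s(3) t sum P show False by auto
    qed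
    have r3: "r = 2 / 3" using x(2) X3 by auto
    \<comment> \<open>\<open>B\<close> belongs to the slope near \<open>1/2\<close> and
      \<open>C\<close> to the one near \<open>1/4\<close>; the right-hand side is
      \<open>3/2 - 2/3 - 1/2 - 1/4\<close>.\<close>
    have solve: "B = 11 \<and> C = 7 \<or> B = 7 \<and> C = 23"
      if "odd B" "odd C" "B \<ge> 7" "C \<ge> 7"
        and "1 / (2 * of_int B) + 1 / (4 * of_int C) + 1 / (6 * rat_of_int B * of_int C) = 1 / 12"
      for B C :: int
    proof (rule reciprocal_sum_sixth)
      have "rat_of_int B > 0" "rat_of_int C > 0" using that by auto
      then have "rat_of_int (6 * C + 3 * B) = of_int (B * C - 2)"
        using that(5) by (simp add: field_simps)
      then show "6 * C + 3 * B = B * C - 2" by (simp only: of_int_eq_iff)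
    qed (use that in auto)
    have P_eq: "P = 1 / (6 * of_int Y * of_int Z)" using 1 X3 by (simp add: P_def)
    \<comment> \<open>Since \<open>s + t + P = 5/6\<close>, two slopes of at most
      \<open>2/7\<close>, or a single one of at most \<open>2/11\<close>, would be too
      small.\<close>
    have "s = 1 / 4 + 1 / (4 * of_int Y) \<and> t = 1 / 2 + 1 / (2 * of_int Z) \<or>
      s = 1 / 2 + 1 / (2 * of_int Y) \<and> t = 1 / 4 + 1 / (4 * of_int Z)"
    proof -
      have u: "0 < 1 / (2 * rat_of_int Y)" "0 < 1 / (2 * rat_of_int Z)" using posr by auto
      have half: "s \<le> 2 / 7 \<Longrightarrow> s \<noteq> 1 / 2 + 1 / (2 * of_int Y)"
        "t \<le> 2 / 7 \<Longrightarrow> t \<noteq> 1 / 2 + 1 / (2 * of_int Z)"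
        using u by linarith+
      have "\<not> s \<le> 2 / 11" "\<not> t \<le> 2 / 11" "s \<le> 2 / 7 \<Longrightarrow> \<not> t \<le> 2 / 7"
        using r3 s(2) t(2) sum P by auto
      moreover have "s \<le> 2 / 7 \<or> t \<le> 2 / 7" using exceptional r3 by auto
      ultimately show ?thesis using y(2) z(2) half by blast
    qed
    \<comment> \<open>Of the two solutions in each case, \<open>Z \<ge> 11\<close> discards the one
      with \<open>Z = 7\<close>.\<close>
    then have "Z = 11 \<and> Y = 7 \<or> Y = 7 \<and> Z = 23"
    proof
      assume "s = 1 / 4 + 1 / (4 * of_int Y) \<and> t = 1 / 2 + 1 / (2 * of_int Z)"
      then show ?thesis
        using solve[of Z Y] sum r3 P_eq odd s(1) t(1) by (auto simp: mult_ac)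
    next
      assume "s = 1 / 2 + 1 / (2 * of_int Y) \<and> t = 1 / 4 + 1 / (4 * of_int Z)"
      then show ?thesis
        using solve[of Y Z] sum r3 P_eq odd s(1) t(1) by (auto simp: mult_ac)
    qed
    then show ?thesis using 1 X3 by auto
  qed
  then show ?thesis by (simp add: defs)
qed

section \<open>From coprime even branches to the list of multiplicities\<close>

text \<open>A submultiset \<open>{#u, v#}\<close> encodes entries at two distinct positions, even
  when their values agree, so pairwise coprimality survives forgetting the order.\<close>

lemma nth_pairwise_imp_mset:
  assumes "\<forall>i<length xs. \<forall>j<length xs. i \<noteq> j \<longrightarrow> R (xs ! i) (xs ! j)" and "{#u, v#} \<subseteq># mset xs"
  shows "R u v"
proof -
  have "u \<in># mset xs" using assms(2) by (meson insert_subset_eq_iff)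
  then obtain ys zs where xs: "xs = ys @ u # zs"
    by (metis in_set_conv_decomp set_mset_mset)
  then have "v \<in> set (ys @ zs)"
    using assms(2) by (auto simp: insert_subset_eq_iff)
  then obtain j where "j < length xs" "j \<noteq> length ys" "xs ! j = v"
  proof (cases "v \<in> set ys")
    case True
    then obtain k where "k < length ys" "ys ! k = v" by (auto simp: in_set_conv_nth)
    then show ?thesis using that[of k] by (auto simp: xs nth_append)
  next
    case False
    then obtain k where "k < length zs" "zs ! k = v"
      using \<open>v \<in> set (ys @ zs)\<close> by (auto simp: in_set_conv_nth)
    then show ?thesis using that[of "length ys + Suc k"] by (auto simp: xs nth_append)
  qed
  then show ?thesis using assms(1) xs by (metis length_append length_Cons less_add_same_cancel1
        nth_append_length zero_less_Suc)
qed

text \<open>Two branches of odd length would have even multiplicities, against coprimality, while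
  the odd total \<open>7\<close> requires at least one. The even branches then have length at least
  2, so there are two or three of them.\<close>

lemma even_star_multiplicities:
  fixes B :: "int list multiset"
  assumes even_branch: "\<forall>b\<in>#B. even_branch b"
    and size: "size B \<ge> 3"
    and length: "(\<Sum>b\<in>#B. length b) = 7"
    and coprime: "\<And>p q. {#p, q#} \<subseteq># image_mset multiplicity B \<Longrightarrow> coprime p q"
    and N: "N = 2 \<or> N \<ge> 4"
    and eq: "(\<Sum>b\<in>#B. slope b) + 1 / of_int (\<Prod>b\<in>#B. multiplicity b) = N"
  shows "image_mset multiplicity B \<in>
    {{#2, 3, 5#}, {#3, 4, 7#}, {#2, 3, 7, 11#}, {#2, 3, 7, 23#}, {#3, 4, 7, 43#}}"
proof -
  have ne: "multiplicity b \<noteq> multiplicity c" if "{#b, c#} \<subseteq># B" for b c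
  proof -
    have "b \<in># B" using that by (meson insert_subset_eq_iff)
    then have "multiplicity b \<ge> 2"
      using multiplicity_ge[of b] even_branch by (cases b) (auto simp: even_branch_def)
    moreover have "coprime (multiplicity b) (multiplicity c)"
      using image_mset_subseteq_mono[OF that, of multiplicity] by (intro coprime) simp
    ultimately show ?thesis by auto
  qed
  have odd: "even (length b) \<or> even (length c)" if "{#b, c#} \<subseteq># B" for b c
  proof -
    have "b \<in># B" "c \<in># B" using that by (auto simp: insert_subset_eq_iff dest: in_diffD)
    moreover have "coprime (multiplicity b) (multiplicity c)"
      using image_mset_subseteq_mono[OF that, of multiplicity] by (intro coprime) simp
    ultimately show ?thesis
      using even_multiplicity_iff even_branch by (metis coprime_common_divisor odd_one)
  qed
  define E D where "E = filter_mset (\<lambda>b. even (length b)) B"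
    and "D = filter_mset (\<lambda>b. odd (length b)) B"
  have B: "B = D + E" by (simp add: E_def D_def add.commute multiset_partition)
  have "size D \<le> 1"
  proof (rule ccontr)
    assume "\<not> size D \<le> 1"
    then obtain b D' where b: "D = add_mset b D'" by (cases D) auto
    with \<open>\<not> size D \<le> 1\<close> obtain c R where "D' = add_mset c R" by (cases D') auto
    with b have "{#b, c#} \<subseteq># B" "b \<in># D" "c \<in># D" by (auto simp: B)
    then show False using odd[of b c] by (auto simp: D_def)
  qed
  moreover have "odd (\<Sum>b\<in>#D. length b)"
  proof -
    have "even (\<Sum>b\<in>#M. length b)" if "\<forall>b\<in>#M. even (length b)" for M :: "int list multiset"
      using that by (induction M) auto
    then have "even (\<Sum>b\<in>#E. length b)" by (simp add: E_def)
    moreover have "odd ((\<Sum>b\<in>#D. length b) + (\<Sum>b\<in>#E. length b))"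
      using length by (simp add: B)
    ultimately show ?thesis by simp
  qed
  ultimately obtain x where D: "D = {#x#}"
    by (cases D) auto
  \<comment> \<open>Sorting by multiplicity, strictly increasing by \<open>ne\<close>, provides the
    order assumed for several branches of length 2.\<close>
  obtain es0 where "mset es0 = E" using ex_mset by blast
  then obtain es where E: "mset es = E" and sorted: "sorted (map multiplicity es)"
    by (metis mset_sort sorted_sort_key)
  have es: "even_branch b" "even (length b)" "length b \<ge> 2" if "b \<in> set es" for b
  proof -
    have "b \<in># E" using that by (simp flip: E)
    then show "even_branch b" "even (length b)"
      using even_branch by (auto simp: E_def)
    then show "length b \<ge> 2" by (cases b; cases "tl b") (auto simp: even_branch_def)
  qed
  have "x \<in># D" by (simp add: D)
  then have x: "even_branch x" "odd (length x)"
    using even_branch by (auto simp: D_def)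
  have Bx: "B = mset (x # es)" by (simp add: B D E)
  have len: "length x + sum_list (map length es) = 7"
    using length by (simp add: Bx sum_mset_sum_list flip: mset_map)
  have eq': "slope x + sum_list (map slope es) +
      1 / (of_int (multiplicity x) * of_int (prod_list (map multiplicity es))) = N"
    using eq by (simp add: Bx sum_mset_sum_list prod_mset_prod_list flip: mset_map)
  have "length es \<ge> 2" using size by (simp add: Bx)
  \<comment> \<open>Four even branches would already have 8 vertices.\<close>
  moreover have "\<not> length es \<ge> 4"
  proof
    assume "length es \<ge> 4"
    moreover have "sum_list (map length es) \<ge> sum_list (map (\<lambda>_. 2) es)"
      by (intro sum_list_mono) (use es in auto)
    ultimately show False using len x(2) by (simp add: sum_list_triv)
  qed
  ultimately consider y z where "es = [y, z]" | w y z where "es = [w, y, z]"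
    by (cases es; cases "tl es"; cases "tl (tl es)"; cases "tl (tl (tl es))") auto
  then show ?thesis
  proof cases
    case 1
    have less: "multiplicity y < multiplicity z"
      using sorted ne[of y z] 1 by (auto simp: Bx add_mset_commute)
    \<comment> \<open>The same equation in the three argument orders needed for the possible
      lengths.\<close>
    have eqs: "slope y + slope z + slope x +
      1 / (of_int (multiplicity y) * of_int (multiplicity z) * of_int (multiplicity x)) = N"
      "slope x + slope y + slope z +
      1 / (of_int (multiplicity x) * of_int (multiplicity y) * of_int (multiplicity z)) = N"
      "slope x + slope z + slope y +
      1 / (of_int (multiplicity x) * of_int (multiplicity z) * of_int (multiplicity y)) = N"
      using eq' 1 by (simp_all add: ac_simps)
    have parity: "even (length y)" "even (length z)" "length y \<ge> 2" "length z \<ge> 2"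
      and sum: "length x + length y + length z = 7"
      using es len 1 by auto
    then have "length y \<le> 5" "length z \<le> 5" by linarith+
    with parity have "length y = 2 \<or> length y = 4" "length z = 2 \<or> length z = 4"
      by presburger+
    then consider "length x = 3" "length y = 2" "length z = 2"
      | "length x = 1" "length y = 2" "length z = 4"
      | "length x = 1" "length y = 4" "length z = 2"
      using sum by fastforce
    then show ?thesis
    proof cases
      case a: 1
      then show ?thesis
        using lengths_2_2_3[OF _ _ x(1) a(2,3,1) less N eqs(1)] es 1
        by (auto simp: Bx add_mset_commute)
    next
      case a: 2
      then show ?thesis
        using lengths_1_2_4[OF x(1) _ _ a N eqs(2)] es 1
        by (auto simp: Bx add_mset_commute)
    next
      case a: 3
      then show ?thesis
        using lengths_1_2_4[OF x(1) _ _ a(1,3,2) N eqs(3)] es 1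
        by (auto simp: Bx add_mset_commute)
    qed
  next
    case 2
    have less: "multiplicity w < multiplicity y" "multiplicity y < multiplicity z"
      using sorted ne[of w y] ne[of y z] 2 by (auto simp: Bx add_mset_commute)
    have eqs: "slope x + slope w + slope y + slope z +
      1 / (of_int (multiplicity x) * of_int (multiplicity w) * of_int (multiplicity y) *
        of_int (multiplicity z)) = N"
      using eq' 2 by (simp add: ac_simps)
    have "length w \<ge> 2" "length y \<ge> 2" "length z \<ge> 2" "length x \<ge> 1"
      "length x + length w + length y + length z = 7"
      using es len 2 x by (auto simp: Suc_le_eq even_branch_def)
    then have "length x = 1" "length w = 2" "length y = 2" "length z = 2" by auto
    from lengths_1_2_2_2[OF x(1) _ _ _ this less N eqs] es 2
    show ?thesis by (auto simp: Bx add_mset_commute)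
  qed
qed

theorem theorem1p4:
  fixes a :: "nat list" and G :: star_graph
  assumes "length a \<ge> 3"
    and "\<forall>x\<in>set a. x \<ge> 2"
    and "\<forall>i<length a. \<forall>j<length a. i \<noteq> j \<longrightarrow> coprime (a ! i) (a ! j)"
    and "minimal_resolution_graph G a"
    and "E8_bounding G (Brieskorn a)"
    and "plumbing_form_isometric G {..<8} neg_E8"
  shows "Brieskorn a \<in>
    {Brieskorn [2, 3, 5], Brieskorn [3, 4, 7], Brieskorn [2, 3, 7, 11],
     Brieskorn [2, 3, 7, 23], Brieskorn [3, 4, 7, 43]}"
proof -
  define bs where "bs = branches G"
  have star: "minimal_star G" and bd: "plumbing_boundary G \<in> Brieskorn a"
    using assms(4) by (auto simp: minimal_resolution_graph_def)
  have even: "even (weight G v)" if "v \<in> vertices G" for v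
    using incidence_weights_even assms(5) that by (auto simp: E8_bounding_def plumbing_spin_def)
  have branch: "even_branch b" if b: "b \<in> set bs" for b
  proof -
    obtain j where j: "j < length bs" "bs ! j = b" using b by (auto simp: in_set_conv_nth)
    have "even m" if m: "m \<in> set b" for m
    proof -
      obtain i where "i < length b" "b ! i = m" using m by (auto simp: in_set_conv_nth)
      then show ?thesis using even[of "Leg j i"] j by (auto simp: vertices_def bs_def)
    qed
    then show ?thesis using star b by (auto simp: even_branch_def minimal_star_def bs_def)
  qed
  have "vertices G \<approx> {..<8 :: nat}" using isometric_imp_eqpoll[OF assms(6)] .
  then have "card (vertices G) = 8"
    by (metis card_lessThan eqpoll_iff_card eqpoll_finite_iff finite_lessThan)
  then have len: "sum_list (map length bs) = 7" by (simp add: card_vertices bs_def)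
  \<comment> \<open>Every branch gives a singular fibre, so the filter in
    \<open>singular_multiplicities\<close> discards nothing.\<close>
  have "\<forall>p\<in>#mset (map multiplicity bs). p \<ge> 2"
  proof -
    have "multiplicity b \<ge> 2" if "b \<in> set bs" for b
      using multiplicity_ge[OF branch[OF that]] branch[OF that]
      by (cases b) (auto simp: even_branch_def)
    then show ?thesis by auto
  qed
  moreover have fibres_eq: "map fst (fibres (plumbing_boundary G)) = map multiplicity bs"
    by (simp add: plumbing_boundary_def bs_def multiplicity_def)
  ultimately have "singular_multiplicities (plumbing_boundary G) = mset (map multiplicity bs)"
    unfolding singular_multiplicities_def fibres_eq filter_mset_eq_conv by simp
  then have mset: "mset (map multiplicity bs) = mset (map int a)"
    using bd by (simp add: Brieskorn_def)
  have prod: "(\<Prod>b\<in>#mset bs. multiplicity b) = int (prod_list a)"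
  proof -
    have "(\<Prod>b\<in>#mset bs. multiplicity b) = prod_mset (mset (map int a))"
      using mset by simp
    also have "\<dots> = int (prod_list a)" by (induction a) auto
    finally show ?thesis .
  qed
  have "euler_number (plumbing_boundary G) = of_int (central_weight G) + (\<Sum>b\<in>#mset bs. slope b)"
    by (simp add: euler_number_def plumbing_boundary_def bs_def slope_def multiplicity_def
        comp_def case_prod_beta sum_mset_sum_list flip: mset_map)
  then have "(\<Sum>b\<in>#mset bs. slope b) + 1 / of_int (\<Prod>b\<in>#mset bs. multiplicity b) =
      of_int (- central_weight G)"
    using bd by (simp add: Brieskorn_def prod)
  \<comment> \<open>Evenness of the central weight rules out \<open>- 1\<close> and
    \<open>- 3\<close>.\<close>
  moreover have "rat_of_int (- central_weight G) = 2 \<or> rat_of_int (- central_weight G) \<ge> 4"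
  proof -
    have "even (central_weight G)" using even[of Centre] by (simp add: vertices_def)
    moreover have "central_weight G \<le> - 1" using star by (simp add: minimal_star_def)
    ultimately have "- central_weight G = 2 \<or> - central_weight G \<ge> 4" by presburger
    then show ?thesis
    proof
      assume "- central_weight G \<ge> 4"
      then have "rat_of_int (- central_weight G) \<ge> of_int 4" by (simp only: of_int_le_iff)
      then show ?thesis by simp
    qed simp
  qed
  moreover have "coprime p q" if "{#p, q#} \<subseteq># image_mset multiplicity (mset bs)" for p q
    using nth_pairwise_imp_mset[of "map int a" coprime p q] that assms(3) mset by simp
  moreover have "size (mset bs) \<ge> 3" using star by (simp add: minimal_star_def bs_def)
  moreover have "(\<Sum>b\<in>#mset bs. length b) = 7"
    using len by (simp add: sum_mset_sum_list flip: mset_map)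
  ultimately have "mset (map int a) \<in>
    {{#2, 3, 5#}, {#3, 4, 7#}, {#2, 3, 7, 11#}, {#2, 3, 7, 23#}, {#3, 4, 7, 43#}}"
    using even_star_multiplicities[of "mset bs"] branch mset by auto
  then have "image_mset int (mset a) \<in> image_mset int `
    {mset [2, 3, 5], mset [3, 4, 7], mset [2, 3, 7, 11], mset [2, 3, 7, 23], mset [3, 4, 7, 43]}"
    by simp
  \<comment> \<open>Injectivity brings the integer multiplicities back to the natural numbers of
    \<open>a\<close>.\<close>
  moreover have "inj (image_mset int)" by (intro multiset.inj_map inj_of_nat)
  ultimately have "mset a \<in>
    {mset [2, 3, 5], mset [3, 4, 7], mset [2, 3, 7, 11], mset [2, 3, 7, 23], mset [3, 4, 7, 43]}"
    by (simp only: inj_image_mem_iff)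
  then show ?thesis using Brieskorn_cong by blast
qed

end
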